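(* Let $x,y_1,\dots,y_n$ be vectors of an inner product space $(H;(\cdot,\cdot))$ over $\mathbb{K}$. Then $\sum_{i=1}^n|(x,y_i)|^2$ is bounded above by $\|x\|$ times each of the following nine quantities: (1) $\max_{1\le i\le n}|(x,y_i)|\left(\sum_{i,j=1}^n|(y_i,y_j)|\right)^{\frac12}$; (2) $\max_{1\le i\le n}|(x,y_i)|^{\frac12}\left(\sum_{i=1}^n|(x,y_i)|^r\right)^{\frac1{2r}}\left[\sum_{i=1}^n\left(\sum_{j=1}^n|(y_i,y_j)|\right)^s\right]^{\frac1{2s}}$, where $\frac1r+\frac1s=1$, $s>1$; (3) $\max_{1\le i\le n}|(x,y_i)|^{\frac12}\left(\sum_{i=1}^n|(x,y_i)|\right)^{\frac12}\left[\max_{1\le i\le n}\left(\sum_{j=1}^n|(y_i,y_j)|\right)\right]$; (4) $\max_{1\le i\le n}|(x,y_i)|^{\frac12}\left(\sum_{i=1}^n|(x,y_i)|^p\right)^{\frac1{2p}}\left[\sum_{i=1}^n\left(\sum_{j=1}^n|(y_i,y_j)|^q\right)^{\frac1q}\right]^{\frac12}$, where $p>1$, $\frac1p+\frac1q=1$; (5) $\left(\sum_{i=1}^n|(x,y_i)|^p\right)^{\frac1{2p}}\left(\sum_{i=1}^n|(x,y_i)|^t\right)^{\frac1{2t}}\left[\sum_{i=1}^n\left(\sum_{j=1}^n|(y_i,y_j)|^q\right)^{\frac uq}\right]^{\frac1{2u}}$, where $p>1$, $\frac1p+\frac1q=1$, $t>1$, $\frac1t+\frac1u=1$; (6) $\left(\sum_{i=1}^n|(x,y_i)|^p\right)^{\frac1{2p}}\left(\sum_{i=1}^n|(x,y_i)|\right)^{\frac12}\max_{1\le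 i\le n}\left\{\left(\sum_{j=1}^n|(y_i,y_j)|^q\right)^{\frac1{2q}}\right\}$, where $p>1$, $\frac1p+\frac1q=1$; (7) $\left[\sum_{i=1}^n|(x,y_i)|\right]^{\frac12}\max_{1\le i\le n}|(x,y_i)|^{\frac12}\left(\sum_{i=1}^n\left[\max_{1\le j\le n}|(y_i,y_j)|\right]\right)^{\frac12}$; (8) $\left[\sum_{i=1}^n|(x,y_i)|^m\right]^{\frac1{2m}}\left[\sum_{i=1}^n\left[\max_{1\le j\le n}|(y_i,y_j)|^l\right]\right]^{\frac1{2l}}$, where $m>1$, $\frac1m+\frac1l=1$; (9) $\sum_{i=1}^n|(x,y_i)|\,\max_{1\le i,j\le n}|(y_i,y_j)|^{\frac12}$.
   Context: $(H;(\cdot,\cdot))$ is an inner product space over the real or complex number field $\mathbb{K}$; $\|x\|=(x,x)^{1/2}$; $n\ge 1$ is an integer. In each listed quantity a maximum applies only to the factor immediately following it, and each sum or maximum is a separate factor with its own dummy index.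
   Formalization: Quantities (3) and (8) are false as printed (n=1 on the real line: x=y_1=1/2; x=y_1=2, m=l=2); in (3) the last factor max_i(sum_j|(y_i,y_j)|) is given exponent 1/2, and (8) gets the additional factor (sum_i|(x,y_i)|)^{1/2}. *)

theory Defs
  imports "HOL-Analysis.Analysis"
begin

(* The scalar fields real and complex in one class.  By the Gelfand-Mazur theorem a
   commutative real_normed_field is isometrically isomorphic to one of the two, and the
   last axiom pins the involution down to the usual conjugation, so the class has no
   further models up to isomorphism. *)
class real_or_complex = real_normed_field +
  fixes conj :: "'a \<Rightarrow> 'a"
  assumes conj_add: "conj (a + b) = conj a + conj b"
    and conj_mult: "conj (a * b) = conj a * conj b"
    and conj_conj: "conj (conj a) = a"
    and mult_conj: "a * conj a = scaleR ((norm a)\<^sup>2) 1"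

instantiation real :: real_or_complex
begin
definition conj_real :: "real \<Rightarrow> real" where "conj_real a = a"
instance
  by standard (simp_all add: conj_real_def power2_eq_square)
end

instantiation complex :: real_or_complex
begin
definition conj_complex :: "complex \<Rightarrow> complex" where "conj_complex = cnj"
instance
  by standard (simp_all add: conj_complex_def complex_norm_square [symmetric] scaleR_conv_of_real)
end

locale inner_product_space = vector_space scale
  for scale :: "'k::real_or_complex \<Rightarrow> 'a::ab_group_add \<Rightarrow> 'a" +
  fixes ip :: "'a \<Rightarrow> 'a \<Rightarrow> 'k"
  assumes ip_add_left: "ip (x + y) z = ip x z + ip y z"
    and ip_scale_left: "ip (scale a x) y = a * ip x y"
    and ip_conj: "ip y x = conj (ip x y)"
    and ip_nonneg: "ip x x \<in> of_real ` {0..}"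
    and ip_definite: "ip x x = 0 \<Longrightarrow> x = 0"

(* (x, x) is a nonnegative real element of the scalar field, so its absolute value is
   (x, x) itself, read as a real number. *)
definition ip_norm :: "('a \<Rightarrow> 'a \<Rightarrow> 'k::real_normed_field) \<Rightarrow> 'a \<Rightarrow> real" where
  "ip_norm ip x = sqrt (norm (ip x x))"

lemma inner_product_space_real_inner:
  "inner_product_space scaleR ((\<bullet>) :: 'a::real_inner \<Rightarrow> 'a \<Rightarrow> real)"
  by unfold_locales
    (auto simp: inner_add_left scaleR_add_right scaleR_add_left conj_real_def
       intro: inner_commute)

lemma ip_norm_inner: "ip_norm (\<bullet>) x = norm (x :: 'a::real_inner)"
  by (simp add: ip_norm_def norm_eq_sqrt_inner)

lemma inner_product_space_complex:
  "inner_product_space (*) (\<lambda>z w :: complex. z * cnj w)"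
  by unfold_locales
    (auto simp: algebra_simps conj_complex_def complex_norm_square [symmetric]
       simp flip: of_real_power)

(* The next two bounds appear in print, but they are not homogeneous of degree 2 in y
   (the second not in x either), and they already fail for n = 1 on the real line.  The
   derivation (Cauchy-Schwarz, then Hoelder applied to the double sum of
   |(x, y_i)| |(x, y_j)| |(y_i, y_j)|) yields them with the exponent 1/2 on the last factor
   of the first one and with the additional factor (sum |(x, y_i)|) powr (1/2) in the second
   one; the main statement uses these corrected forms. *)
lemma printed_row_sum_max_bound_fails:
  "\<not> (\<forall>(x::real) (y :: nat \<Rightarrow> real) n. n \<ge> 1 \<longrightarrow>
     (\<Sum>i=1..n. (norm (x \<bullet> y i))\<^sup>2)
       \<le> norm x * ((MAX i\<in>{1..n}. norm (x \<bullet> y i) powr (1/2))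
           * (\<Sum>i=1..n. norm (x \<bullet> y i)) powr (1/2)
           * (MAX i\<in>{1..n}. \<Sum>j=1..n. norm (y i \<bullet> y j))))"
proof
  assume H: "\<forall>(x::real) (y :: nat \<Rightarrow> real) n. n \<ge> 1 \<longrightarrow>
     (\<Sum>i=1..n. (norm (x \<bullet> y i))\<^sup>2)
       \<le> norm x * ((MAX i\<in>{1..n}. norm (x \<bullet> y i) powr (1/2))
           * (\<Sum>i=1..n. norm (x \<bullet> y i)) powr (1/2)
           * (MAX i\<in>{1..n}. \<Sum>j=1..n. norm (y i \<bullet> y j)))"
  show False
    using H [rule_format, of 1 "1/2" "\<lambda>_. 1/2"]
    by (simp add: powr_half_sqrt power2_eq_square)
qed

lemma printed_row_max_Hoelder_bound_fails:
  "\<not> (\<forall>(x::real) (y :: nat \<Rightarrow> real) n m l. n \<ge> 1 \<and> m > 1 \<and> 1/m + 1/l = 1 \<longrightarrow>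
     (\<Sum>i=1..n. (norm (x \<bullet> y i))\<^sup>2)
       \<le> norm x * ((\<Sum>i=1..n. norm (x \<bullet> y i) powr m) powr (1/(2 * m))
           * (\<Sum>i=1..n. MAX j\<in>{1..n}. norm (y i \<bullet> y j) powr l) powr (1/(2 * l))))"
proof
  assume H: "\<forall>(x::real) (y :: nat \<Rightarrow> real) n m l. n \<ge> 1 \<and> m > 1 \<and> 1/m + 1/l = 1 \<longrightarrow>
     (\<Sum>i=1..n. (norm (x \<bullet> y i))\<^sup>2)
       \<le> norm x * ((\<Sum>i=1..n. norm (x \<bullet> y i) powr m) powr (1/(2 * m))
           * (\<Sum>i=1..n. MAX j\<in>{1..n}. norm (y i \<bullet> y j) powr l) powr (1/(2 * l)))"
  show False
    using H [rule_format, of 1 2 2 2 "\<lambda>_. 2"]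
    by (simp add: powr_powr power2_eq_square powr_half_sqrt)
qed

end

theory Submission
  imports Defs
begin

text \<open>
  Write \<open>a\<^sub>i = |(x, y\<^sub>i)|\<close> and \<open>G\<^sub>i\<^sub>j = |(y\<^sub>i, y\<^sub>j)|\<close>.
  The sum of the \<open>a\<^sub>i\<^sup>2\<close> equals \<open>(x, z)\<close> for
  \<open>z = \<Sum>\<^sub>i (x, y\<^sub>i) y\<^sub>i\<close>, so the Cauchy--Schwarz inequality together with
  the triangle inequality for \<open>(z, z)\<close> gives
  \<open>\<Sum>\<^sub>i a\<^sub>i\<^sup>2 \<le> \<parallel>x\<parallel> (\<Sum>\<^sub>i a\<^sub>i \<Sum>\<^sub>j a\<^sub>j G\<^sub>i\<^sub>j)\<^bsup>1/2\<^esup>\<close>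
  (lemma \<open>bessel_type_bound\<close>).

  What remains concerns nonnegative reals only.  A pairing \<open>\<Sum> a b\<close> can be estimated by
  the max-norm of \<open>a\<close> times the sum of \<open>b\<close>, by the sum of \<open>a\<close> times the max-norm
  of \<open>b\<close>, or by Hoelder's inequality.  Choosing one of the three for the inner sum over
  \<open>j\<close> and one for the outer sum over \<open>i\<close> gives nine bounds for the double sum
  (lemma \<open>double_sum_bound\<close> composes the two choices), and their square roots are the nine
  quantities of the theorem.
\<close>

section \<open>Pairings of nonnegative families\<close>

lemma conjugate_exponent_gt_1:
  fixes p q :: real
  assumes "p > 1" "1/p + 1/q = 1"
  shows "q > 1"
proof -
  have "0 < 1/p" "1/p < 1"
    using assms(1) by auto
  then have "1/q > 0" "1/q < 1"
    using assms(2) by linarith+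
  then show ?thesis
    by (simp add: divide_less_eq split: if_splits)
qed

text \<open>
  If one of the two power sums vanishes, so does every product; otherwise both families are
  normalized to have power sum 1 and Young's inequality is summed up.
\<close>
lemma Hoelder_sum:
  fixes f g :: "'i \<Rightarrow> real" and p q :: real
  assumes A: "finite A" and p: "p > 1" and pq: "1/p + 1/q = 1"
    and f: "\<And>i. i \<in> A \<Longrightarrow> 0 \<le> f i" and g: "\<And>i. i \<in> A \<Longrightarrow> 0 \<le> g i"
  shows "(\<Sum>i\<in>A. f i * g i)
    \<le> (\<Sum>i\<in>A. f i powr p) powr (1/p) * (\<Sum>i\<in>A. g i powr q) powr (1/q)"
proof -
  define F where "F = (\<Sum>i\<in>A. f i powr p)"
  define G where "G = (\<Sum>i\<in>A. g i powr q)"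
  have q: "q > 1"
    using p pq by (rule conjugate_exponent_gt_1)
  have nonneg: "F \<ge> 0" "G \<ge> 0"
    by (auto simp: F_def G_def intro: sum_nonneg)
  show ?thesis
  proof (cases "F = 0 \<or> G = 0")
    case True
    then have "f i * g i = 0" if "i \<in> A" for i
      using that A by (auto simp: F_def G_def sum_nonneg_eq_0_iff)
    then have "(\<Sum>i\<in>A. f i * g i) = 0"
      by (rule sum.neutral [rule_format])
    then show ?thesis
      by simp
  next
    case False
    then have pos: "F > 0" "G > 0"
      using nonneg by auto
    define c where "c = F powr (1/p) * G powr (1/q)"
    have c: "c > 0"
      using pos by (simp add: c_def)
    have "f i * g i / c \<le> f i powr p / F / p + g i powr q / G / q" if "i \<in> A" for i
      using Youngs_inequality [OF p q pq, of "f i / F powr (1/p)" "g i / G powr (1/q)"]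
        f [OF that] g [OF that] p q pos
      by (simp add: c_def powr_divide powr_powr)
    then have "(\<Sum>i\<in>A. f i * g i / c) \<le> (\<Sum>i\<in>A. f i powr p / F / p + g i powr q / G / q)"
      by (rule sum_mono)
    also have "\<dots> = F / F / p + G / G / q"
      by (simp add: sum.distrib F_def G_def flip: sum_divide_distrib)
    also have "\<dots> = 1"
      using pos pq by simp
    finally have "(\<Sum>i\<in>A. f i * g i) / c \<le> 1"
      by (simp add: sum_divide_distrib)
    then show ?thesis
      using c by (simp add: c_def F_def G_def)
  qed
qed

lemma sum_mult_le_Max_sum:
  fixes f g :: "'i \<Rightarrow> real"
  assumes "finite A" "\<And>i. i \<in> A \<Longrightarrow> 0 \<le> g i"
  shows "(\<Sum>i\<in>A. f i * g i) \<le> (MAX i\<in>A. f i) * (\<Sum>i\<in>A. g i)"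
  unfolding sum_distrib_left using assms by (intro sum_mono mult_right_mono) auto

lemma sum_mult_le_sum_Max:
  fixes f g :: "'i \<Rightarrow> real"
  assumes "finite A" "\<And>i. i \<in> A \<Longrightarrow> 0 \<le> f i"
  shows "(\<Sum>i\<in>A. f i * g i) \<le> (\<Sum>i\<in>A. f i) * (MAX i\<in>A. g i)"
  using sum_mult_le_Max_sum [of A f g] assms by (simp add: mult.commute)

lemma Max_nonneg:
  fixes f :: "'i \<Rightarrow> real"
  assumes "finite A" "A \<noteq> {}" "\<And>i. i \<in> A \<Longrightarrow> 0 \<le> f i"
  shows "0 \<le> (MAX i\<in>A. f i)"
  using assms by (auto simp: Max_ge_iff)

lemma Max_powr:
  fixes f :: "'i \<Rightarrow> real"
  assumes A: "finite A" "A \<noteq> {}" and f: "\<And>i. i \<in> A \<Longrightarrow> 0 \<le> f i" and e: "0 \<le> e"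
  shows "(MAX i\<in>A. f i powr e) = (MAX i\<in>A. f i) powr e"
proof (rule Max_eqI)
  show "finite ((\<lambda>i. f i powr e) ` A)"
    using A by simp
  show "b \<le> (MAX i\<in>A. f i) powr e" if "b \<in> (\<lambda>i. f i powr e) ` A" for b
    using that A f e by (auto intro!: powr_mono2)
  obtain i where "i \<in> A" "(MAX i\<in>A. f i) = f i"
    using obtains_MAX [OF A] by metis
  then show "(MAX i\<in>A. f i) powr e \<in> (\<lambda>i. f i powr e) ` A"
    by auto
qed

text \<open>
  \<open>P R\<^sub>i\<close> is the estimate chosen for the inner pairing and \<open>Q V\<close> the one chosen for the
  outer pairing of \<open>a\<close> with the resulting family \<open>R\<close>.
\<close>
lemma double_sum_bound:
  fixes a R :: "'i \<Rightarrow> real" and G :: "'i \<Rightarrow> 'i \<Rightarrow> real"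
  assumes a: "\<And>i. i \<in> A \<Longrightarrow> 0 \<le> a i" and P: "0 \<le> P"
    and inner: "\<And>i. i \<in> A \<Longrightarrow> (\<Sum>j\<in>A. a j * G i j) \<le> P * R i"
    and outer: "(\<Sum>i\<in>A. a i * R i) \<le> Q * V"
  shows "(\<Sum>i\<in>A. a i * (\<Sum>j\<in>A. a j * G i j)) \<le> P * Q * V"
proof -
  have "(\<Sum>i\<in>A. a i * (\<Sum>j\<in>A. a j * G i j)) \<le> (\<Sum>i\<in>A. a i * (P * R i))"
    using a inner by (intro sum_mono mult_left_mono) auto
  also have "\<dots> = P * (\<Sum>i\<in>A. a i * R i)"
    by (simp add: sum_distrib_left mult.left_commute)
  also have "\<dots> \<le> P * (Q * V)"
    using outer P by (rule mult_left_mono)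
  finally show ?thesis
    by (simp add: mult.assoc)
qed

section \<open>The scalar field and the Cauchy--Schwarz inequality\<close>

lemma conj_0: "conj (0 :: 'k::real_or_complex) = 0"
  using conj_add [of "0 :: 'k" 0] by simp

lemma conj_sum: "conj (\<Sum>i\<in>A. f i) = (\<Sum>i\<in>A. conj (f i :: 'k::real_or_complex))"
  by (induction A rule: infinite_finite_induct) (simp_all add: conj_0 conj_add)

lemma mult_conj_of_real: "a * conj a = of_real ((norm (a :: 'k::real_or_complex))\<^sup>2)"
  by (simp add: mult_conj of_real_def)

text \<open>
  Real linearity of the involution is not an axiom of the class; on real scalars it is recovered
  from \<open>a conj a = |a|\<^sup>2\<close> by cancelling \<open>a\<close>.
\<close>
lemma conj_of_real: "conj (of_real r :: 'k::real_or_complex) = of_real r"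
proof (cases "r = 0")
  case False
  have "of_real r * conj (of_real r :: 'k) = of_real r * of_real r"
    by (simp add: mult_conj_of_real power2_eq_square flip: of_real_mult)
  with False show ?thesis
    by simp
qed (simp add: conj_0)

lemma norm_conj: "norm (conj (a :: 'k::real_or_complex)) = norm a"
proof (cases "a = 0")
  case False
  have "norm a * norm (conj a) = norm a * norm a"
    by (simp add: mult_conj_of_real power2_eq_square flip: norm_mult)
  with False show ?thesis
    by simp
qed (simp add: conj_0)

context inner_product_space
begin

lemma ip_zero_left: "ip 0 z = 0"
  using ip_add_left [of 0 0 z] by simp

lemma ip_sum_left: "ip (\<Sum>i\<in>A. f i) z = (\<Sum>i\<in>A. ip (f i) z)"
  by (induction A rule: infinite_finite_induct) (simp_all add: ip_zero_left ip_add_left)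

lemma ip_sum_right: "ip z (\<Sum>i\<in>A. f i) = (\<Sum>i\<in>A. ip z (f i))"
  by (subst ip_conj) (simp add: ip_sum_left conj_sum flip: ip_conj)

lemma ip_add_right: "ip z (u + v) = ip z u + ip z v"
  by (subst ip_conj) (simp add: ip_add_left conj_add flip: ip_conj)

lemma ip_scale_right: "ip z (scale a v) = conj a * ip z v"
  by (subst ip_conj) (simp add: ip_scale_left conj_mult flip: ip_conj)

lemma ip_self: "ip u u = of_real (norm (ip u u))"
  using ip_nonneg [of u] by auto

text \<open>
  With \<open>X = (x, x)\<close>, \<open>Z = (z, z)\<close> and \<open>c = (x, z)\<close>, the vector \<open>Z x - c z\<close> has
  square norm \<open>Z (X Z - |c|\<^sup>2)\<close>, which is nonnegative, and \<open>Z\<close> is positive unless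
  \<open>z = 0\<close>.
\<close>
lemma ip_Cauchy_Schwarz: "(norm (ip x z))\<^sup>2 \<le> norm (ip x x) * norm (ip z z)"
proof (cases "z = 0")
  case True
  then show ?thesis
    by (subst ip_conj) (simp add: ip_zero_left conj_0)
next
  case False
  define X where "X = norm (ip x x)"
  define Z where "Z = norm (ip z z)"
  define c where "c = ip x z"
  define w where "w = scale (of_real Z) x + scale (- c) z"
  have X: "ip x x = of_real X" and Z: "ip z z = of_real Z"
    unfolding X_def Z_def by (rule ip_self)+
  have zx: "ip z x = conj c"
    unfolding c_def by (rule ip_conj)
  have minus: "conj (- c) = - conj c"
    using conj_add [of c "- c"] by (simp add: conj_0 eq_neg_iff_add_eq_0 add.commute)
  have "ip w w = of_real (Z * Z * X) - of_real Z * (c * conj c)"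
    unfolding w_def
    by (simp add: ip_add_left ip_add_right ip_scale_left ip_scale_right X Z zx minus
        conj_of_real algebra_simps flip: c_def del: scale_minus_left)
  also have "\<dots> = of_real (Z * (Z * X - (norm c)\<^sup>2))"
    by (simp add: mult_conj_of_real algebra_simps)
  finally have "Z * (Z * X - (norm c)\<^sup>2) \<ge> 0"
    using ip_nonneg [of w] by (auto simp flip: of_real_mult of_real_diff)
  moreover have "Z > 0"
    using False ip_definite [of z] by (auto simp: Z_def)
  ultimately show ?thesis
    by (simp add: zero_le_mult_iff X_def Z_def c_def mult.commute)
qed

text \<open>
  The test vector \<open>z = \<Sum>\<^sub>i (x, y\<^sub>i) y\<^sub>i\<close> makes \<open>(x, z)\<close> equal to the sum to be
  bounded; the double sum on the right majorizes \<open>(z, z)\<close>.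
\<close>
lemma bessel_type_bound:
  "(\<Sum>i\<in>A. (norm (ip x (y i)))\<^sup>2)
    \<le> ip_norm ip x
      * (\<Sum>i\<in>A. norm (ip x (y i)) * (\<Sum>j\<in>A. norm (ip x (y j)) * norm (ip (y i) (y j))))
          powr (1/2)"
    (is "?S \<le> _ * ?T powr _")
proof -
  define z where "z = (\<Sum>i\<in>A. scale (ip x (y i)) (y i))"
  have ip_z: "ip u z = (\<Sum>j\<in>A. conj (ip x (y j)) * ip u (y j))" for u
    by (simp add: z_def ip_sum_right ip_scale_right)
  have z_ip: "ip z u = (\<Sum>i\<in>A. ip x (y i) * ip (y i) u)" for u
    by (simp add: z_def ip_sum_left ip_scale_left)
  have "ip x z = of_real ?S"
    by (simp add: ip_z mult.commute [of "conj _"] mult_conj_of_real)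
  then have "norm (ip x z) = ?S"
    by (simp add: sum_nonneg del: of_real_sum)
  then have "?S\<^sup>2 \<le> norm (ip x x) * norm (ip z z)"
    using ip_Cauchy_Schwarz [of x z] by simp
  also have "norm (ip z z) \<le> ?T"
  proof -
    have "ip z z
        = (\<Sum>i\<in>A. ip x (y i) * (\<Sum>j\<in>A. conj (ip x (y j)) * ip (y i) (y j)))"
      by (subst z_ip) (simp add: ip_z)
    also have "norm \<dots> \<le> ?T"
      by (intro sum_norm_le)
        (auto simp: norm_mult norm_conj intro!: mult_left_mono sum_norm_le)
    finally show ?thesis .
  qed
  finally have "?S\<^sup>2 \<le> norm (ip x x) * ?T"
    by (simp add: mult_left_mono)
  then have "?S \<le> sqrt (norm (ip x x) * ?T)"
    by (rule real_le_rsqrt)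
  then show ?thesis
    by (simp add: ip_norm_def real_sqrt_mult powr_half_sqrt sum_nonneg)
qed

end

section \<open>The nine bounds\<close>

theorem mainTheorem5:
  fixes scale :: "'k::real_or_complex \<Rightarrow> 'a::ab_group_add \<Rightarrow> 'a"
    and ip :: "'a \<Rightarrow> 'a \<Rightarrow> 'k"
    and x :: 'a and y :: "nat \<Rightarrow> 'a" and n :: nat
  assumes "inner_product_space scale ip"
    and "n \<ge> 1"
  shows
    "(\<Sum>i=1..n. (norm (ip x (y i)))\<^sup>2)
        \<le> ip_norm ip x *
          ((MAX i\<in>{1..n}. norm (ip x (y i)))
           * (\<Sum>(i,j)\<in>{1..n}\<times>{1..n}. norm (ip (y i) (y j))) powr (1/2))
     \<and>
     (\<forall>r s :: real. s > 1 \<and> 1/r + 1/s = 1 \<longrightarrow>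
      (\<Sum>i=1..n. (norm (ip x (y i)))\<^sup>2)
        \<le> ip_norm ip x *
          ((MAX i\<in>{1..n}. norm (ip x (y i)) powr (1/2))
           * (\<Sum>i=1..n. norm (ip x (y i)) powr r) powr (1/(2 * r))
           * (\<Sum>i=1..n. (\<Sum>j=1..n. norm (ip (y i) (y j))) powr s) powr (1/(2 * s))))
     \<and>
     (\<Sum>i=1..n. (norm (ip x (y i)))\<^sup>2)
        \<le> ip_norm ip x *
          ((MAX i\<in>{1..n}. norm (ip x (y i)) powr (1/2))
           * (\<Sum>i=1..n. norm (ip x (y i))) powr (1/2)
           * (MAX i\<in>{1..n}. \<Sum>j=1..n. norm (ip (y i) (y j))) powr (1/2))
     \<and>
     (\<forall>p q :: real. p > 1 \<and> 1/p + 1/q = 1 \<longrightarrow>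
      (\<Sum>i=1..n. (norm (ip x (y i)))\<^sup>2)
        \<le> ip_norm ip x *
          ((MAX i\<in>{1..n}. norm (ip x (y i)) powr (1/2))
           * (\<Sum>i=1..n. norm (ip x (y i)) powr p) powr (1/(2 * p))
           * (\<Sum>i=1..n. (\<Sum>j=1..n. norm (ip (y i) (y j)) powr q) powr (1/q)) powr (1/2)))
     \<and>
     (\<forall>p q t u :: real. p > 1 \<and> 1/p + 1/q = 1 \<and> t > 1 \<and> 1/t + 1/u = 1 \<longrightarrow>
      (\<Sum>i=1..n. (norm (ip x (y i)))\<^sup>2)
        \<le> ip_norm ip x *
          ((\<Sum>i=1..n. norm (ip x (y i)) powr p) powr (1/(2 * p))
           * (\<Sum>i=1..n. norm (ip x (y i)) powr t) powr (1/(2 * t))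
           * (\<Sum>i=1..n. (\<Sum>j=1..n. norm (ip (y i) (y j)) powr q) powr (u/q)) powr (1/(2 * u))))
     \<and>
     (\<forall>p q :: real. p > 1 \<and> 1/p + 1/q = 1 \<longrightarrow>
      (\<Sum>i=1..n. (norm (ip x (y i)))\<^sup>2)
        \<le> ip_norm ip x *
          ((\<Sum>i=1..n. norm (ip x (y i)) powr p) powr (1/(2 * p))
           * (\<Sum>i=1..n. norm (ip x (y i))) powr (1/2)
           * (MAX i\<in>{1..n}. (\<Sum>j=1..n. norm (ip (y i) (y j)) powr q) powr (1/(2 * q)))))
     \<and>
     (\<Sum>i=1..n. (norm (ip x (y i)))\<^sup>2)
        \<le> ip_norm ip x *
          ((\<Sum>i=1..n. norm (ip x (y i))) powr (1/2)
           * (MAX i\<in>{1..n}. norm (ip x (y i)) powr (1/2))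
           * (\<Sum>i=1..n. MAX j\<in>{1..n}. norm (ip (y i) (y j))) powr (1/2))
     \<and>
     (\<forall>m l :: real. m > 1 \<and> 1/m + 1/l = 1 \<longrightarrow>
      (\<Sum>i=1..n. (norm (ip x (y i)))\<^sup>2)
        \<le> ip_norm ip x *
          ((\<Sum>i=1..n. norm (ip x (y i))) powr (1/2)
           * (\<Sum>i=1..n. norm (ip x (y i)) powr m) powr (1/(2 * m))
           * (\<Sum>i=1..n. MAX j\<in>{1..n}. norm (ip (y i) (y j)) powr l) powr (1/(2 * l))))
     \<and>
     (\<Sum>i=1..n. (norm (ip x (y i)))\<^sup>2)
        \<le> ip_norm ip x *
          ((\<Sum>i=1..n. norm (ip x (y i)))
           * (MAX (i,j)\<in>{1..n}\<times>{1..n}. norm (ip (y i) (y j)) powr (1/2)))"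
proof -
  interpret inner_product_space scale ip
    by fact
  let ?A = "{1..n}"
  define a where "a i = norm (ip x (y i))" for i
  define G where "G i j = norm (ip (y i) (y j))" for i j
  have A: "finite ?A" "?A \<noteq> {}"
    using assms(2) by auto
  have a: "0 \<le> a i" and G: "0 \<le> G i j" for i j
    by (simp_all add: a_def G_def)
  have N: "0 \<le> ip_norm ip x"
    by (simp add: ip_norm_def)
  have sum_a: "0 \<le> (\<Sum>i\<in>?A. a i)"
    by (simp add: a sum_nonneg)
  have Max_a: "0 \<le> (MAX i\<in>?A. a i)"
    using A a by (intro Max_nonneg) auto
  have Max_G: "0 \<le> (MAX j\<in>?A. G i j)" for i
    using A G by (intro Max_nonneg) auto
  have Max_a_half: "(MAX i\<in>?A. a i powr (1/2)) = (MAX i\<in>?A. a i) powr (1/2)"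
    using A a by (intro Max_powr) auto

  (* Taking the square root of the double sum turns the product P Q V into the displayed
     product of factors, so that each of the nine bounds only needs its two pairings. *)
  have reduce: "(\<Sum>i=1..n. (a i)\<^sup>2) \<le> ip_norm ip x * W"
    if P: "0 \<le> P"
      and inner: "\<And>i. i \<in> ?A \<Longrightarrow> (\<Sum>j\<in>?A. a j * G i j) \<le> P * R i"
      and outer: "(\<Sum>i\<in>?A. a i * R i) \<le> Q * V"
      and W: "W = P powr (1/2) * Q powr (1/2) * V powr (1/2)"
    for P Q V W :: real and R
  proof -
    have "(\<Sum>i\<in>?A. a i * (\<Sum>j\<in>?A. a j * G i j)) \<le> P * Q * V"
      using a P inner outer by (rule double_sum_bound)
    then have "(\<Sum>i\<in>?A. a i * (\<Sum>j\<in>?A. a j * G i j)) powr (1/2) \<le> W"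
      unfolding W powr_mult [symmetric]
      by (intro powr_mono2) (auto intro!: sum_nonneg mult_nonneg_nonneg a G)
    then have "ip_norm ip x * (\<Sum>i\<in>?A. a i * (\<Sum>j\<in>?A. a j * G i j)) powr (1/2)
        \<le> ip_norm ip x * W"
      using N by (rule mult_left_mono)
    then show ?thesis
      using bessel_type_bound [of x y ?A] by (simp add: a_def G_def)
  qed

  have inner_Max: "(\<Sum>j\<in>?A. a j * G i j) \<le> (MAX j\<in>?A. a j) * (\<Sum>j\<in>?A. G i j)" for i
    using G by (intro sum_mult_le_Max_sum) auto
  have inner_Hoelder: "(\<Sum>j\<in>?A. a j * G i j)
      \<le> (\<Sum>j\<in>?A. a j powr p) powr (1/p) * (\<Sum>j\<in>?A. G i j powr q) powr (1/q)"
    if "p > 1" "1/p + 1/q = 1" for i and p q :: real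
    using that a G by (intro Hoelder_sum) auto
  have inner_sum: "(\<Sum>j\<in>?A. a j * G i j) \<le> (\<Sum>j\<in>?A. a j) * (MAX j\<in>?A. G i j)" for i
    using a by (intro sum_mult_le_sum_Max) auto

  have outer_Max: "(\<Sum>i\<in>?A. a i * R i) \<le> (MAX i\<in>?A. a i) * (\<Sum>i\<in>?A. R i)"
    if "\<And>i. 0 \<le> R i" for R
    using that by (intro sum_mult_le_Max_sum) auto
  have outer_Hoelder: "(\<Sum>i\<in>?A. a i * R i)
      \<le> (\<Sum>i\<in>?A. a i powr p) powr (1/p) * (\<Sum>i\<in>?A. R i powr q) powr (1/q)"
    if "p > 1" "1/p + 1/q = 1" "\<And>i. 0 \<le> R i" for R and p q :: real
    using that a by (intro Hoelder_sum) auto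
  have outer_sum: "(\<Sum>i\<in>?A. a i * R i) \<le> (\<Sum>i\<in>?A. a i) * (MAX i\<in>?A. R i)" for R
    using a by (intro sum_mult_le_sum_Max) auto

  have 1: "(\<Sum>i=1..n. (a i)\<^sup>2)
      \<le> ip_norm ip x * ((MAX i\<in>?A. a i) * (\<Sum>(i,j)\<in>?A\<times>?A. G i j) powr (1/2))"
    by (rule reduce [OF Max_a inner_Max outer_Max])
      (use Max_a in \<open>auto simp: G sum_nonneg sum.cartesian_product powr_half_sqrt\<close>)
  have 2: "(\<Sum>i=1..n. (a i)\<^sup>2)
      \<le> ip_norm ip x * ((MAX i\<in>?A. a i powr (1/2))
        * (\<Sum>i=1..n. a i powr r) powr (1/(2 * r))
        * (\<Sum>i=1..n. (\<Sum>j=1..n. G i j) powr s) powr (1/(2 * s)))"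
    if "s > 1" "1/r + 1/s = 1" for r s :: real
  proof -
    have "r > 1"
      using that conjugate_exponent_gt_1 [of s r] by simp
    then show ?thesis
      using that unfolding Max_a_half
      by (intro reduce [OF Max_a inner_Max outer_Hoelder [where p = r and q = s]])
        (auto simp: G sum_nonneg powr_powr mult.commute)
  qed
  have 3: "(\<Sum>i=1..n. (a i)\<^sup>2)
      \<le> ip_norm ip x * ((MAX i\<in>?A. a i powr (1/2))
        * (\<Sum>i=1..n. a i) powr (1/2)
        * (MAX i\<in>?A. \<Sum>j=1..n. G i j) powr (1/2))"
    unfolding Max_a_half by (rule reduce [OF Max_a inner_Max outer_sum]) simp
  have 4: "(\<Sum>i=1..n. (a i)\<^sup>2)
      \<le> ip_norm ip x * ((MAX i\<in>?A. a i powr (1/2))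
        * (\<Sum>i=1..n. a i powr p) powr (1/(2 * p))
        * (\<Sum>i=1..n. (\<Sum>j=1..n. G i j powr q) powr (1/q)) powr (1/2))"
    if "p > 1" "1/p + 1/q = 1" for p q :: real
    unfolding Max_a_half
    by (rule reduce [OF _ inner_Hoelder [OF that] outer_Max])
      (auto simp: powr_powr mult.commute)
  have 5: "(\<Sum>i=1..n. (a i)\<^sup>2)
      \<le> ip_norm ip x * ((\<Sum>i=1..n. a i powr p) powr (1/(2 * p))
        * (\<Sum>i=1..n. a i powr t) powr (1/(2 * t))
        * (\<Sum>i=1..n. (\<Sum>j=1..n. G i j powr q) powr (u/q)) powr (1/(2 * u)))"
    if pq: "p > 1" "1/p + 1/q = 1" and tu: "t > 1" "1/t + 1/u = 1" for p q t u :: real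
    by (rule reduce [OF _ inner_Hoelder [OF pq] outer_Hoelder [OF tu]])
      (auto simp: powr_powr mult.commute)
  have 6: "(\<Sum>i=1..n. (a i)\<^sup>2)
      \<le> ip_norm ip x * ((\<Sum>i=1..n. a i powr p) powr (1/(2 * p))
        * (\<Sum>i=1..n. a i) powr (1/2)
        * (MAX i\<in>?A. (\<Sum>j=1..n. G i j powr q) powr (1/(2 * q))))"
    if "p > 1" "1/p + 1/q = 1" for p q :: real
  proof -
    have "(MAX i\<in>?A. (\<Sum>j=1..n. G i j powr q) powr (1/(2 * q)))
        = (MAX i\<in>?A. (\<Sum>j=1..n. G i j powr q) powr (1/q)) powr (1/2)"
      using Max_powr [of ?A "\<lambda>i. (\<Sum>j=1..n. G i j powr q) powr (1/q)" "1/2"] A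
      by (simp add: powr_powr mult.commute)
    then show ?thesis
      by (intro reduce [OF _ inner_Hoelder [OF that] outer_sum])
        (auto simp: powr_powr mult.commute)
  qed
  have 7: "(\<Sum>i=1..n. (a i)\<^sup>2)
      \<le> ip_norm ip x * ((\<Sum>i=1..n. a i) powr (1/2)
        * (MAX i\<in>?A. a i powr (1/2))
        * (\<Sum>i=1..n. MAX j\<in>?A. G i j) powr (1/2))"
    unfolding Max_a_half by (rule reduce [OF sum_a inner_sum outer_Max [OF Max_G]]) simp
  have 8: "(\<Sum>i=1..n. (a i)\<^sup>2)
      \<le> ip_norm ip x * ((\<Sum>i=1..n. a i) powr (1/2)
        * (\<Sum>i=1..n. a i powr m) powr (1/(2 * m))
        * (\<Sum>i=1..n. MAX j\<in>?A. G i j powr l) powr (1/(2 * l)))"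
    if "m > 1" "1/m + 1/l = 1" for m l :: real
  proof -
    have "l > 1"
      using that by (rule conjugate_exponent_gt_1)
    then have "(MAX j\<in>?A. G i j powr l) = (MAX j\<in>?A. G i j) powr l" for i
      using A G by (intro Max_powr) auto
    then show ?thesis
      by (intro reduce [OF sum_a inner_sum outer_Hoelder [OF that Max_G]])
        (auto simp: powr_powr mult.commute)
  qed
  have 9: "(\<Sum>i=1..n. (a i)\<^sup>2)
      \<le> ip_norm ip x * ((\<Sum>i=1..n. a i)
        * (MAX (i,j)\<in>?A\<times>?A. G i j powr (1/2)))"
  proof -
    (* The constant family with value the overall maximum serves as R, so that the outer
       pairing is an identity. *)
    let ?M = "MAX (i,j)\<in>?A\<times>?A. G i j"
    have "G i j \<le> ?M" if "i \<in> ?A" "j \<in> ?A" for i j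
      using that by (intro Max_ge) force+
    then have inner: "(\<Sum>j\<in>?A. a j * G i j) \<le> (\<Sum>j\<in>?A. a j) * ?M" if "i \<in> ?A" for i
      unfolding sum_distrib_right using that a by (intro sum_mono mult_left_mono) auto
    have outer: "(\<Sum>i\<in>?A. a i * ?M) \<le> (\<Sum>i\<in>?A. a i) * ?M"
      by (simp add: sum_distrib_right)
    have "(MAX (i,j)\<in>?A\<times>?A. G i j powr (1/2)) = ?M powr (1/2)"
      using Max_powr [of "?A \<times> ?A" "\<lambda>(i,j). G i j" "1/2"] A G
      by (simp add: case_prod_unfold)
    then show ?thesis
      using sum_a by (intro reduce [OF sum_a inner outer]) (auto simp: powr_half_sqrt)
  qed

  show ?thesis
    using 1 2 3 4 5 6 7 8 9 unfolding a_def G_def by blast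
qed

end
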